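(* There exists a function $\mathrm{A}:2^{<\omega}\to\mathbb{N}$ satisfying all of the following: (1) $\mathrm{A}$ is upper semi-computable, i.e. the predicate "$\mathrm{A}(x)\le k$" is computably enumerable uniformly in $x$ and $k$; (2) there is a constant $c$ such that $\mathrm{A}(x)\le |x|+c$ for all $x\in 2^{<\omega}$; (3) there is a constant $d$ such that $|\{x\in 2^{<\omega} : \mathrm{A}(x)\le n\}|\le d\cdot 2^{n}$ for all $n\in\mathbb{N}$; (4) for every total computable function $f:2^{<\omega}\to 2^{<\omega}$ there exists a constant $c_f$ such that $\mathrm{A}(f(x))\le \mathrm{A}(x)+c_f$ for every $x\in 2^{<\omega}$; (5) $|\mathrm{A}(x)-\mathrm{C}(x)|$ is unbounded as $x$ ranges over $2^{<\omega}$.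
   Context: $2^{<\omega}$ denotes the set of finite binary strings, identified with natural numbers in the standard way; $|x|$ is the length of $x$. For a Turing machine $T$, $\mathrm{C}_T(x)=\min\{|y| : T(y)=x\}$. A machine $\mathbb{U}$ is optimal if for every machine $T$ there is a constant $c_T$ with $\mathrm{C}_{\mathbb{U}}(x)\le \mathrm{C}_T(x)+c_T$ for all $x$; fix such an optimal $\mathbb{U}$ and let $\mathrm{C}=\mathrm{C}_{\mathbb{U}}$ be plain Kolmogorov complexity. *)

theory Defs
  imports Main "HOL-Library.Extended_Nat"
begin

text \<open>Finite binary strings are bool lists (most significant bit first).
  The standard identification: the string x corresponds to the number whose
  binary expansion is 1x, minus 1 (so [] = 0, [0] = 1, [1] = 2, [0,0] = 3, ...).\<close>

definition str_to_nat :: "bool list \<Rightarrow> nat" where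
  "str_to_nat x = foldl (\<lambda>n b. 2 * n + (if b then 1 else 0)) 1 x - 1"

datatype recf =
    Z
  | S
  | Id nat
  | Cn recf "recf list"
  | Pr recf recf
  | Mn recf

inductive eval :: "recf \<Rightarrow> nat list \<Rightarrow> nat \<Rightarrow> bool" where
  eval_Z: "eval Z xs 0"
| eval_S: "eval S (x # xs) (Suc x)"
| eval_Id: "i < length xs \<Longrightarrow> eval (Id i) xs (xs ! i)"
| eval_Cn: "length ys = length gs \<Longrightarrow> (\<forall>i < length gs. eval (gs ! i) xs (ys ! i))
             \<Longrightarrow> eval f ys z \<Longrightarrow> eval (Cn f gs) xs z"
| eval_Pr0: "eval f xs z \<Longrightarrow> eval (Pr f g) (0 # xs) z"
| eval_PrS: "eval (Pr f g) (n # xs) y \<Longrightarrow> eval g (n # y # xs) z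
             \<Longrightarrow> eval (Pr f g) (Suc n # xs) z"
| eval_Mn: "eval f (n # xs) 0 \<Longrightarrow> (\<forall>m < n. \<exists>y. eval f (m # xs) (Suc y))
             \<Longrightarrow> eval (Mn f) xs n"

text \<open>A (Turing) machine on strings is given by a code p of a partial recursive
  function: machine p on input y halts with output x iff
  eval p [str_to_nat y] (str_to_nat x).\<close>

definition runs :: "recf \<Rightarrow> bool list \<Rightarrow> bool list \<Rightarrow> bool" where
  "runs p y x \<longleftrightarrow> eval p [str_to_nat y] (str_to_nat x)"

definition total_computable :: "(bool list \<Rightarrow> bool list) \<Rightarrow> bool" where
  "total_computable f \<longleftrightarrow> (\<exists>p. \<forall>x. runs p x (f x))"

text \<open>C_T(x) = min {|y| : T(y) = x}, infinity if no such y.\<close>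

definition KC :: "recf \<Rightarrow> bool list \<Rightarrow> enat" where
  "KC T x = (INF y \<in> {y. runs T y x}. enat (length y))"

definition optimal :: "recf \<Rightarrow> bool" where
  "optimal U \<longleftrightarrow> (\<forall>T. \<exists>c::nat. \<forall>x. KC U x \<le> KC T x + enat c)"

text \<open>A : strings \<rightarrow> nat is upper semi-computable if the relation A(x) \<le> k is
  computably enumerable uniformly in x and k, i.e. it is the domain of a
  partial recursive function of two arguments.\<close>

definition upper_semicomputable :: "(bool list \<Rightarrow> nat) \<Rightarrow> bool" where
  "upper_semicomputable A \<longleftrightarrow>
     (\<exists>p. \<forall>x k. A x \<le> k \<longleftrightarrow> (\<exists>y. eval p [str_to_nat x, k] y))"

end

theory Submission
  imports Defs
begin

text \<open>Let \<open>A x\<close> be the least \<open>k\<close> for which some running time \<open>s\<close> of complexity at most \<open>k / 2\<close>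
  lets \<open>U\<close> produce \<open>x\<close> within \<open>s\<close> steps from a program of length at most \<open>k\<close>. Since the
  largest numbers of complexity \<open>k / 2\<close> outgrow every computable function of \<open>k\<close>, strings reach
  their length bound in time, and applying a total computable map costs only a computable
  increase of \<open>s\<close>, hence \<open>O(1)\<close>. A partial map cannot be applied in this way: from the largest
  \<open>s\<close> of complexity at most \<open>n\<close> one computes a string that \<open>U\<close> does not produce by stage
  \<open>s\<close>. It has complexity \<open>n + O(1)\<close>, but \<open>A\<close> exceeds \<open>2 * n\<close> there.\<close>

section \<open>Total computable functions\<close>

text \<open>Values are prescribed on lists of length \<open>n\<close> alone, so arguments can be
  addressed by \<open>!\<close> and \<open>tl\<close> without guarding against short lists.\<close>

definition computable :: "nat \<Rightarrow> (nat list \<Rightarrow> nat) \<Rightarrow> bool" where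
  "computable n F \<longleftrightarrow> (\<exists>p. \<forall>xs. length xs = n \<longrightarrow> eval p xs (F xs))"

definition decidable :: "nat \<Rightarrow> (nat list \<Rightarrow> bool) \<Rightarrow> bool" where
  "decidable n P \<longleftrightarrow> computable n (\<lambda>xs. if P xs then 1 else 0)"

section \<open>Composition and primitive recursion\<close>

lemma computable_cong:
  assumes "computable n F" "\<And>xs. length xs = n \<Longrightarrow> F xs = G xs"
  shows "computable n G"
  using assms unfolding computable_def by metis

lemma computable_zero: "computable n (\<lambda>_. 0)"
  unfolding computable_def using eval_Z by blast

lemma computable_nth: "i < n \<Longrightarrow> computable n (\<lambda>xs. xs ! i)"
  unfolding computable_def using eval_Id by blast

lemma computable_compose:
  assumes F: "computable (length Gs) F" and Gs: "\<And>G. G \<in> set Gs \<Longrightarrow> computable n G"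
  shows "computable n (\<lambda>xs. F (map (\<lambda>G. G xs) Gs))"
proof -
  obtain pf where pf: "\<And>xs. length xs = length Gs \<Longrightarrow> eval pf xs (F xs)"
    using F unfolding computable_def by blast
  have "\<forall>G\<in>set Gs. \<exists>p. \<forall>xs. length xs = n \<longrightarrow> eval p xs (G xs)"
    using Gs unfolding computable_def by blast
  then obtain pg where pg: "\<And>G xs. G \<in> set Gs \<Longrightarrow> length xs = n \<Longrightarrow> eval (pg G) xs (G xs)"
    by metis
  have "eval (Cn pf (map pg Gs)) xs (F (map (\<lambda>G. G xs) Gs))" if "length xs = n" for xs
    by (rule eval_Cn[where ys = "map (\<lambda>G. G xs) Gs"]) (use that pf pg in auto)
  then show ?thesis
    unfolding computable_def by blast
qed

lemma computable_compose1:
  assumes "computable 1 (\<lambda>xs. f (xs ! 0))" "computable n G"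
  shows "computable n (\<lambda>xs. f (G xs))"
  using computable_compose[of "[G]" "\<lambda>xs. f (xs ! 0)" n] assms by simp

lemma computable_compose2:
  assumes "computable 2 (\<lambda>xs. f (xs ! 0) (xs ! 1))" "computable n G" "computable n H"
  shows "computable n (\<lambda>xs. f (G xs) (H xs))"
  using computable_compose[of "[G, H]" "\<lambda>xs. f (xs ! 0) (xs ! 1)" n] assms
  by (auto simp: numeral_2_eq_2)

lemma computable_Suc:
  assumes "computable n F"
  shows "computable n (\<lambda>xs. Suc (F xs))"
proof (rule computable_compose1[OF _ assms])
  have "eval S xs (Suc (xs ! 0))" if "length xs = 1" for xs
    using that eval_S by (cases xs) auto
  then show "computable 1 (\<lambda>xs. Suc (xs ! 0))"
    unfolding computable_def by blast
qed

lemma computable_const: "computable n (\<lambda>_. c)"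
  by (induction c) (auto intro: computable_zero computable_Suc)

text \<open>\<open>Pr\<close> recurses on the head of its list, so the program first computes the
  bound and rebuilds the parameters behind it by projections. In the hypothesis on \<open>G\<close>
  the step receives the counter, the previous value and then the parameters.\<close>

lemma computable_rec_nat:
  assumes N: "computable n N" and F: "computable n F"
    and G: "computable (Suc (Suc n)) (\<lambda>ys. G (ys ! 0) (ys ! 1) (tl (tl ys)))"
  shows "computable n (\<lambda>xs. rec_nat (F xs) (\<lambda>i r. G i r xs) (N xs))"
proof -
  obtain pN where pN: "\<And>xs. length xs = n \<Longrightarrow> eval pN xs (N xs)"
    using N unfolding computable_def by blast
  obtain pF where pF: "\<And>xs. length xs = n \<Longrightarrow> eval pF xs (F xs)"
    using F unfolding computable_def by blast
  obtain pG where pG: "\<And>ys. length ys = Suc (Suc n) \<Longrightarrow>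
      eval pG ys (G (ys ! 0) (ys ! 1) (tl (tl ys)))"
    using G unfolding computable_def by blast
  have rec: "eval (Pr pF pG) (k # xs) (rec_nat (F xs) (\<lambda>i r. G i r xs) k)"
    if "length xs = n" for k xs
  proof (induction k)
    case 0
    then show ?case using pF[OF that] by (simp add: eval_Pr0)
  next
    case (Suc k)
    from eval_PrS[OF Suc pG[of "k # rec_nat (F xs) (\<lambda>i r. G i r xs) k # xs", simplified]] that
    show ?case by simp
  qed
  have "eval (Cn (Pr pF pG) (pN # map Id [0..<n])) xs
      (rec_nat (F xs) (\<lambda>i r. G i r xs) (N xs))" if len: "length xs = n" for xs
  proof (rule eval_Cn[where ys = "N xs # xs"])
    show "length (N xs # xs) = length (pN # map Id [0..<n])"
      using len by simp
    show "\<forall>i<length (pN # map Id [0..<n]).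
        eval ((pN # map Id [0..<n]) ! i) xs ((N xs # xs) ! i)"
      using len pN by (auto simp: nth_Cons split: nat.split intro: eval_Id)
    show "eval (Pr pF pG) (N xs # xs) (rec_nat (F xs) (\<lambda>i r. G i r xs) (N xs))"
      by (rule rec[OF len])
  qed
  then show ?thesis
    unfolding computable_def by blast
qed

lemma computable_append_drop:
  assumes F: "computable (length Gs + (n - k)) F" and Gs: "\<And>G. G \<in> set Gs \<Longrightarrow> computable n G"
  shows "computable n (\<lambda>xs. F (map (\<lambda>G. G xs) Gs @ drop k xs))"
proof -
  have "computable n (\<lambda>xs. F (map (\<lambda>G. G xs) (Gs @ map (\<lambda>i xs. xs ! (k + i)) [0..<n - k])))"
    by (rule computable_compose) (use F Gs in \<open>auto intro!: computable_nth\<close>)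
  then show ?thesis
    by (rule computable_cong) (auto intro!: arg_cong[where f = F] nth_equalityI)
qed

lemma computable_tl:
  assumes "computable n F"
  shows "computable (Suc n) (\<lambda>xs. F (tl xs))"
  using computable_append_drop[of "[]" "Suc n" 1 F] assms by (simp add: drop_Suc)

section \<open>Arithmetic\<close>

lemma computable_add:
  assumes "computable n F" "computable n G"
  shows "computable n (\<lambda>xs. F xs + G xs)"
proof -
  have "computable n (\<lambda>xs. rec_nat (F xs) (\<lambda>i r. Suc r) (G xs))"
    by (intro computable_rec_nat assms computable_Suc computable_nth) simp
  moreover have "rec_nat a (\<lambda>i r. Suc r) b = a + b" for a b :: nat
    by (induction b) auto
  ultimately show ?thesis by simp
qed

lemma computable_mult:
  assumes "computable n F" "computable n G"
  shows "computable n (\<lambda>xs. F xs * G xs)"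
proof -
  have "computable n (\<lambda>xs. rec_nat 0 (\<lambda>i r. r + F xs) (G xs))"
    by (intro computable_rec_nat assms computable_add computable_nth computable_tl
        computable_const) simp
  moreover have "rec_nat 0 (\<lambda>i r. r + a) b = a * b" for a b :: nat
    by (induction b) auto
  ultimately show ?thesis by simp
qed

lemma computable_power:
  assumes "computable n F" "computable n G"
  shows "computable n (\<lambda>xs. F xs ^ G xs)"
proof -
  have "computable n (\<lambda>xs. rec_nat 1 (\<lambda>i r. r * F xs) (G xs))"
    by (intro computable_rec_nat assms computable_mult computable_nth computable_tl
        computable_const) simp
  moreover have "rec_nat 1 (\<lambda>i r. r * a) b = a ^ b" for a b :: nat
    by (induction b) auto
  ultimately show ?thesis by simp
qed

lemma computable_diff:
  assumes "computable n F" "computable n G"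
  shows "computable n (\<lambda>xs. F xs - G xs)"
proof -
  \<comment> \<open>Returning the counter and discarding the previous value yields the predecessor;
    truncated subtraction iterates it.\<close>
  have pred: "computable 1 (\<lambda>xs. rec_nat 0 (\<lambda>i r. i) (xs ! 0))"
    by (intro computable_rec_nat computable_nth computable_const) auto
  have pred_eq: "rec_nat 0 (\<lambda>i r. i) k = k - 1" for k :: nat
    by (cases k) auto
  have "computable n (\<lambda>xs. rec_nat (F xs) (\<lambda>i r. r - 1) (G xs))"
    by (intro computable_rec_nat assms computable_compose1[OF pred[unfolded pred_eq]]
        computable_nth) simp
  moreover have "rec_nat a (\<lambda>i r. r - 1) b = a - b" for a b :: nat
    by (induction b) auto
  ultimately show ?thesis by simp
qed

section \<open>Case distinction and decidable predicates\<close>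

lemma computable_if:
  assumes "decidable n P" "computable n F" "computable n G"
  shows "computable n (\<lambda>xs. if P xs then F xs else G xs)"
proof -
  have "computable n (\<lambda>xs. rec_nat (G xs) (\<lambda>i r. F xs) (if P xs then 1 else 0))"
    by (intro computable_rec_nat computable_tl assms assms(1)[unfolded decidable_def])
  then show ?thesis
    by (rule computable_cong) simp
qed

lemma decidable_not:
  assumes "decidable n P"
  shows "decidable n (\<lambda>xs. \<not> P xs)"
proof -
  have "computable n (\<lambda>xs. if P xs then 0 else 1)"
    by (intro computable_if computable_const assms)
  then show ?thesis
    unfolding decidable_def by (rule computable_cong) simp
qed

lemma decidable_conj:
  assumes "decidable n P" "decidable n Q"
  shows "decidable n (\<lambda>xs. P xs \<and> Q xs)"
proof -
  have "computable n (\<lambda>xs. if P xs then if Q xs then 1 else 0 else 0)"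
    by (intro computable_if computable_const assms)
  then show ?thesis
    unfolding decidable_def by (rule computable_cong) simp
qed

lemma decidable_disj:
  assumes "decidable n P" "decidable n Q"
  shows "decidable n (\<lambda>xs. P xs \<or> Q xs)"
proof -
  have "decidable n (\<lambda>xs. \<not> (\<not> P xs \<and> \<not> Q xs))"
    by (intro decidable_not decidable_conj assms)
  then show ?thesis by simp
qed

lemma decidable_le:
  assumes "computable n F" "computable n G"
  shows "decidable n (\<lambda>xs. F xs \<le> G xs)"
proof -
  have "computable n (\<lambda>xs. 1 - (F xs - G xs))"
    by (intro computable_diff computable_const assms)
  then show ?thesis
    unfolding decidable_def by (rule computable_cong) auto
qed

lemma decidable_eq:
  assumes "computable n F" "computable n G"
  shows "decidable n (\<lambda>xs. F xs = G xs)"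
  unfolding eq_iff by (intro decidable_conj decidable_le assms)

text \<open>\<open>Mn\<close> looks for a zero, so it is run on the characteristic function of the
  negation; the hypothesis \<open>ex\<close> makes the search total.\<close>

lemma computable_Least:
  assumes P: "decidable (Suc n) (\<lambda>ys. P (ys ! 0) (tl ys))"
    and ex: "\<And>xs. length xs = n \<Longrightarrow> \<exists>i. P i xs"
  shows "computable n (\<lambda>xs. LEAST i. P i xs)"
proof -
  obtain p where p': "\<And>ys. length ys = Suc n \<Longrightarrow> eval p ys (if \<not> P (ys ! 0) (tl ys) then 1 else 0)"
    using decidable_not[OF P] unfolding decidable_def computable_def by blast
  have p: "eval p (i # xs) (if P i xs then 0 else Suc 0)" if "length xs = n" for i xs
    using p'[of "i # xs"] that by (cases "P i xs") auto
  have "eval (Mn p) xs (LEAST i. P i xs)" if len: "length xs = n" for xs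
  proof (rule eval_Mn)
    show "eval p ((LEAST i. P i xs) # xs) 0"
      using p[OF len, of "LEAST i. P i xs"] LeastI_ex[OF ex[OF len]] by simp
    show "\<forall>m<LEAST i. P i xs. \<exists>y. eval p (m # xs) (Suc y)"
      using p[OF len] not_less_Least by (metis (mono_tags, lifting))
  qed
  then show ?thesis
    unfolding computable_def by blast
qed

lemma decidable_compose_Cons:
  assumes P: "decidable (Suc n) (\<lambda>ys. P (ys ! 0) (tl ys))" and F: "computable n F"
  shows "decidable n (\<lambda>xs. P (F xs) xs)"
  using computable_append_drop[of "[F]" n 0 "\<lambda>ys. if P (ys ! 0) (tl ys) then 1 else 0"] P F
  by (simp add: decidable_def)

lemma decidable_bex:
  assumes N: "computable n N" and P: "decidable (Suc n) (\<lambda>ys. P (ys ! 0) (tl ys))"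
  shows "decidable n (\<lambda>xs. \<exists>i\<le>N xs. P i xs)"
proof -
  \<comment> \<open>The disjunct \<open>N xs \<le> i\<close> stops the search at the bound at the
    latest, which makes it total; testing \<open>P\<close> where it stopped decides the
    quantifier.\<close>
  let ?L = "\<lambda>xs. LEAST i. P i xs \<or> N xs \<le> i"
  have "computable n ?L"
    by (intro computable_Least decidable_disj P decidable_le computable_tl computable_nth N) auto
  then have "decidable n (\<lambda>xs. P (?L xs) xs)"
    by (rule decidable_compose_Cons[OF P])
  moreover have "P (?L xs) xs \<longleftrightarrow> (\<exists>i\<le>N xs. P i xs)" for xs
  proof
    assume "P (?L xs) xs"
    moreover have "?L xs \<le> N xs" by (rule Least_le) simp
    ultimately show "\<exists>i\<le>N xs. P i xs" by blast
  next
    assume "\<exists>i\<le>N xs. P i xs"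
    then obtain i where i: "i \<le> N xs" "P i xs" by blast
    have "?L xs \<le> i" by (rule Least_le) (simp add: i)
    moreover have "P (?L xs) xs \<or> N xs \<le> ?L xs"
      by (rule LeastI[of _ i]) (simp add: i)
    ultimately show "P (?L xs) xs"
      using i by (metis le_antisym le_trans)
  qed
  ultimately show ?thesis by simp
qed

lemma decidable_ball:
  assumes N: "computable n N" and P: "decidable (Suc n) (\<lambda>ys. P (ys ! 0) (tl ys))"
  shows "decidable n (\<lambda>xs. \<forall>i\<le>N xs. P i xs)"
proof -
  have "decidable n (\<lambda>xs. \<not> (\<exists>i\<le>N xs. \<not> P i xs))"
    by (intro decidable_not decidable_bex N P)
  then show ?thesis by simp
qed

lemma decidable_ball_set:
  assumes "\<And>G. G \<in> set Gs \<Longrightarrow> decidable n (P G)"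
  shows "decidable n (\<lambda>xs. \<forall>G\<in>set Gs. P G xs)"
  using assms
proof (induction Gs)
  case Nil
  show ?case
    by (simp add: decidable_def computable_const)
next
  case (Cons G Gs)
  then show ?case
    by (auto intro!: decidable_conj)
qed

lemmas computable_intros =
  computable_nth computable_tl computable_Suc computable_const computable_add computable_mult
  computable_power computable_diff computable_if
  decidable_not decidable_conj decidable_disj decidable_le decidable_eq decidable_bex decidable_ball

inductive_cases eval_ZE: "eval Z xs z"
inductive_cases eval_SE: "eval S xs z"
inductive_cases eval_IdE: "eval (Id i) xs z"
inductive_cases eval_PrE: "eval (Pr f g) xs z"
inductive_cases eval_MnE: "eval (Mn f) xs z"

section \<open>Staged evaluation\<close>

text \<open>\<open>H (s # xs)\<close> is the outcome after \<open>s\<close> stages: \<open>0\<close> for no result so far,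
  \<open>Suc z\<close> for the result \<open>z\<close>.\<close>

definition stages :: "nat \<Rightarrow> (nat list \<Rightarrow> nat \<Rightarrow> bool) \<Rightarrow> (nat list \<Rightarrow> nat) \<Rightarrow> bool" where
  "stages n R H \<longleftrightarrow> computable (Suc n) H \<and>
     (\<forall>s t xs z. length xs = n \<longrightarrow> s \<le> t \<longrightarrow> H (s # xs) = Suc z \<longrightarrow> H (t # xs) = Suc z) \<and>
     (\<forall>xs z. length xs = n \<longrightarrow> (R xs z \<longleftrightarrow> (\<exists>s. H (s # xs) = Suc z)))"

lemma stagesD:
  assumes "stages n R H"
  shows "computable (Suc n) H"
    "\<And>s t xs z. length xs = n \<Longrightarrow> s \<le> t \<Longrightarrow> H (s # xs) = Suc z \<Longrightarrow> H (t # xs) = Suc z"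
    "\<And>xs z. length xs = n \<Longrightarrow> R xs z \<longleftrightarrow> (\<exists>s. H (s # xs) = Suc z)"
  using assms unfolding stages_def by blast+

section \<open>Stage functions for the program constructors\<close>

text \<open>All programs in \<open>gs\<close>, and then \<open>f\<close>, are run for the same
  number of stages. Since outcomes persist, finitely many stages can be replaced by their maximum,
  so a common stage loses no results.\<close>

lemma stages_eval_Cn:
  assumes f: "stages (length gs) (eval f) Hf"
    and gs: "\<And>g. g \<in> set gs \<Longrightarrow> stages n (eval g) (Hg g)"
  shows "\<exists>H. stages n (eval (Cn f gs)) H"
proof -
  define H where "H = (\<lambda>ys. if \<forall>g\<in>set gs. Hg g ys \<noteq> 0
      then Hf (ys ! 0 # map (\<lambda>g. Hg g ys - 1) gs) else 0)"
  have "computable (Suc n)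
      (\<lambda>ys. Hf (map (\<lambda>G. G ys) ((\<lambda>ys. ys ! 0) # map (\<lambda>g ys. Hg g ys - 1) gs)))"
    by (rule computable_compose)
      (use stagesD(1)[OF f] stagesD(1)[OF gs] in \<open>auto intro!: computable_intros\<close>)
  then have "computable (Suc n) (\<lambda>ys. Hf (ys ! 0 # map (\<lambda>g. Hg g ys - 1) gs))"
    by (simp add: comp_def)
  then have "computable (Suc n) H"
    unfolding H_def
    by (intro computable_if decidable_ball_set decidable_not decidable_eq computable_const
        stagesD(1)[OF gs])
  moreover have H_eq: "H (s # xs) = Suc z \<longleftrightarrow>
      (\<exists>ys. length ys = length gs \<and> (\<forall>i<length gs. Hg (gs ! i) (s # xs) = Suc (ys ! i)) \<and>
        Hf (s # ys) = Suc z)" for s xs z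
  proof
    assume H: "H (s # xs) = Suc z"
    then show "\<exists>ys. length ys = length gs \<and>
        (\<forall>i<length gs. Hg (gs ! i) (s # xs) = Suc (ys ! i)) \<and> Hf (s # ys) = Suc z"
      by (intro exI[of _ "map (\<lambda>g. Hg g (s # xs) - 1) gs"])
        (auto simp: H_def split: if_splits)
  next
    assume "\<exists>ys. length ys = length gs \<and>
        (\<forall>i<length gs. Hg (gs ! i) (s # xs) = Suc (ys ! i)) \<and> Hf (s # ys) = Suc z"
    then obtain ys where ys: "length ys = length gs"
      "\<And>i. i < length gs \<Longrightarrow> Hg (gs ! i) (s # xs) = Suc (ys ! i)" "Hf (s # ys) = Suc z"
      by blast
    have "map (\<lambda>g. Hg g (s # xs) - 1) gs = ys"
      using ys by (intro nth_equalityI) auto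
    moreover have "\<forall>g\<in>set gs. Hg g (s # xs) \<noteq> 0"
      using ys(2) by (metis in_set_conv_nth nat.distinct(1))
    ultimately show "H (s # xs) = Suc z"
      using ys(3) by (simp add: H_def)
  qed
  moreover have "H (t # xs) = Suc z"
    if len: "length xs = n" and le: "s \<le> t" and H: "H (s # xs) = Suc z" for s t xs z
  proof -
    obtain ys where ys: "length ys = length gs"
      "\<And>i. i < length gs \<Longrightarrow> Hg (gs ! i) (s # xs) = Suc (ys ! i)" "Hf (s # ys) = Suc z"
      using H unfolding H_eq by blast
    have "Hg (gs ! i) (t # xs) = Suc (ys ! i)" if "i < length gs" for i
      by (rule stagesD(2)[OF gs len le ys(2)]) (simp_all add: that)
    then show ?thesis
      unfolding H_eq using ys(1) stagesD(2)[OF f ys(1) le ys(3)] by blast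
  qed
  moreover have "eval (Cn f gs) xs z \<longleftrightarrow> (\<exists>s. H (s # xs) = Suc z)" if len: "length xs = n" for xs z
  proof
    assume "eval (Cn f gs) xs z"
    then obtain ys where ys: "length ys = length gs"
      "\<And>i. i < length gs \<Longrightarrow> eval (gs ! i) xs (ys ! i)" "eval f ys z"
      by cases auto
    have "\<forall>i\<in>{..<length gs}. \<exists>s. Hg (gs ! i) (s # xs) = Suc (ys ! i)"
      using ys(2) stagesD(3)[OF gs len] by auto
    then obtain s where s: "\<And>i. i < length gs \<Longrightarrow> Hg (gs ! i) (s i # xs) = Suc (ys ! i)"
      by (metis lessThan_iff)
    obtain u where u: "Hf (u # ys) = Suc z"
      using ys(3) stagesD(3)[OF f ys(1)] by blast
    define t where "t = Max (insert u (s ` {..<length gs}))"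
    have t: "s i \<le> t" if "i < length gs" for i
      using that unfolding t_def by (auto intro: Max_ge)
    have "u \<le> t"
      unfolding t_def by (auto intro: Max_ge)
    then have "Hf (t # ys) = Suc z"
      using stagesD(2)[OF f ys(1) _ u] by simp
    moreover have "Hg (gs ! i) (t # xs) = Suc (ys ! i)" if "i < length gs" for i
      by (rule stagesD(2)[OF gs len t s]) (simp_all add: that)
    ultimately show "\<exists>s. H (s # xs) = Suc z"
      unfolding H_eq using ys(1) by blast
  next
    assume "\<exists>s. H (s # xs) = Suc z"
    then obtain s ys where ys: "length ys = length gs"
      "\<And>i. i < length gs \<Longrightarrow> Hg (gs ! i) (s # xs) = Suc (ys ! i)" "Hf (s # ys) = Suc z"
      unfolding H_eq by blast
    have "eval (gs ! i) xs (ys ! i)" if "i < length gs" for i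
      using stagesD(3)[OF gs[OF nth_mem[OF that]] len] ys(2)[OF that] by blast
    moreover have "eval f ys z"
      using stagesD(3)[OF f ys(1)] ys(3) by blast
    ultimately show "eval (Cn f gs) xs z"
      using eval_Cn[OF ys(1)] by blast
  qed
  ultimately show ?thesis
    unfolding stages_def by blast
qed

text \<open>One stage number serves every level of the recursion, and a level without result passes
  \<open>0\<close> on to all later ones. The stages of the recursive call and of \<open>g\<close>
  are joined by taking their maximum.\<close>

lemma stages_eval_Pr:
  assumes f: "stages n (eval f) Hf" and g: "stages (Suc (Suc n)) (eval g) Hg"
  shows "\<exists>H. stages (Suc n) (eval (Pr f g)) H"
proof -
  define R where "R = (\<lambda>s xs. rec_nat (Hf (s # xs))
      (\<lambda>i r. if r = 0 then 0 else Hg (s # i # (r - 1) # xs)))"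
  define H where "H = (\<lambda>ys. R (ys ! 0) (tl (tl ys)) (ys ! 1))"
  have cf: "computable (Suc (Suc n)) (\<lambda>ys. Hf (ys ! 0 # tl (tl ys)))"
    using computable_append_drop[of "[\<lambda>ys. ys ! 0]" "Suc (Suc n)" 2 Hf] stagesD(1)[OF f]
    by (simp add: computable_nth drop_Suc numeral_2_eq_2)
  \<comment> \<open>The recursion step sees \<open>i # r # s # k # xs\<close>; the selectors
    rearrange this into \<open>s # i # (r - 1) # xs\<close>.\<close>
  let ?Gs = "[\<lambda>ys. tl (tl ys) ! 0, \<lambda>ys. ys ! 0, \<lambda>ys. ys ! 1 - 1]"
  have "computable (Suc (Suc (Suc (Suc n)))) (\<lambda>ys. Hg (map (\<lambda>G. G ys) ?Gs @ drop 4 ys))"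
    by (rule computable_append_drop)
      (use stagesD(1)[OF g] in \<open>auto intro!: computable_intros\<close>)
  then have cg: "computable (Suc (Suc (Suc (Suc n))))
      (\<lambda>ys. Hg (tl (tl ys) ! 0 # ys ! 0 # (ys ! 1 - 1) # tl (tl (tl (tl ys)))))"
    by (simp add: drop_Suc eval_nat_numeral)
  have "computable (Suc (Suc n)) H"
    unfolding H_def R_def
    by (intro computable_rec_nat computable_if decidable_eq cf cg computable_nth computable_const)
      auto
  moreover have mono: "R t xs k = Suc z"
    if len: "length xs = n" and le: "s \<le> t" and "R s xs k = Suc z" for s t xs k z
    using that(3)
  proof (induction k arbitrary: z)
    case 0
    then show ?case
      using stagesD(2)[OF f len le] by (simp add: R_def)
  next
    case (Suc k)
    then obtain y where y: "R s xs k = Suc y" "Hg (s # k # y # xs) = Suc z"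
      by (cases "R s xs k") (auto simp: R_def)
    then show ?case
      using Suc.IH[OF y(1)] stagesD(2)[OF g _ le] len by (simp add: R_def)
  qed
  moreover have "eval (Pr f g) (k # xs) z \<longleftrightarrow> (\<exists>s. R s xs k = Suc z)" if len: "length xs = n"
    for k xs z
  proof (induction k arbitrary: z)
    case 0
    show ?case
      using stagesD(3)[OF f len] by (auto simp: R_def intro: eval_Pr0 elim: eval_PrE)
  next
    case (Suc k)
    show ?case
    proof
      assume "eval (Pr f g) (Suc k # xs) z"
      then obtain y where y: "eval (Pr f g) (k # xs) y" "eval g (k # y # xs) z"
        by (auto elim: eval_PrE)
      then obtain s u where s: "R s xs k = Suc y" and u: "Hg (u # k # y # xs) = Suc z"
        using Suc stagesD(3)[OF g, of "k # y # xs"] len by auto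
      have "R (max s u) xs k = Suc y"
        by (rule mono[OF len _ s]) simp
      moreover have "Hg (max s u # k # y # xs) = Suc z"
        by (rule stagesD(2)[OF g _ _ u]) (simp_all add: len)
      ultimately have "R (max s u) xs (Suc k) = Suc z"
        by (simp add: R_def)
      then show "\<exists>s. R s xs (Suc k) = Suc z" ..
    next
      assume "\<exists>s. R s xs (Suc k) = Suc z"
      then obtain s where s: "R s xs (Suc k) = Suc z" ..
      then obtain y where y: "R s xs k = Suc y" "Hg (s # k # y # xs) = Suc z"
        by (cases "R s xs k") (auto simp: R_def)
      then show "eval (Pr f g) (Suc k # xs) z"
        using Suc stagesD(3)[OF g, of "k # y # xs"] len by (auto intro: eval_PrS)
    qed
  qed
  ultimately have "stages (Suc n) (eval (Pr f g)) H"
    unfolding stages_def H_def by (auto simp: length_Suc_conv)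
  then show ?thesis by blast
qed

lemma stages_eval_Mn:
  assumes f: "stages (Suc n) (eval f) Hf"
  shows "\<exists>H. stages n (eval (Mn f)) H"
proof -
  \<comment> \<open>With outcomes shifted by one, \<open>1\<close> means that \<open>f\<close> was
    found to be \<open>0\<close>, and \<open>2\<close> or more that a positive value was found. So
    \<open>P i\<close> says that stage \<open>ys ! 0\<close> already confirms \<open>i\<close> as
    the result of the minimization.\<close>
  define P where "P = (\<lambda>i ys. Hf (ys ! 0 # i # tl ys) = 1 \<and>
      (\<forall>m\<le>i. m = i \<or> 2 \<le> Hf (ys ! 0 # m # tl ys)))"
  \<comment> \<open>Bounding the search by the stage keeps \<open>H\<close> total even where
    \<open>Mn f\<close> diverges.\<close>
  define H where "H = (\<lambda>ys. if \<exists>i\<le>ys ! 0. P i ys then Suc (LEAST i. P i ys \<or> ys ! 0 \<le> i) else 0)"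
  have "computable (Suc (Suc n)) (\<lambda>ys. Hf (map (\<lambda>G. G ys) [\<lambda>ys. tl ys ! 0, \<lambda>ys. ys ! 0] @ drop 2 ys))"
    by (rule computable_append_drop)
      (use stagesD(1)[OF f] in \<open>auto intro!: computable_intros\<close>)
  then have cf: "computable (Suc (Suc n)) (\<lambda>ys. Hf (tl ys ! 0 # ys ! 0 # tl (tl ys)))"
    by (simp add: drop_Suc eval_nat_numeral)
  have "computable (Suc (Suc (Suc n)))
      (\<lambda>ys. Hf (map (\<lambda>G. G ys) [\<lambda>ys. tl (tl ys) ! 0, \<lambda>ys. ys ! 0] @ drop 3 ys))"
    by (rule computable_append_drop)
      (use stagesD(1)[OF f] in \<open>auto intro!: computable_intros\<close>)
  then have cf': "computable (Suc (Suc (Suc n))) (\<lambda>ys. Hf (tl (tl ys) ! 0 # ys ! 0 # tl (tl (tl ys))))"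
    by (simp add: drop_Suc eval_nat_numeral)
  have dP: "decidable (Suc (Suc n)) (\<lambda>ys. P (ys ! 0) (tl ys))"
    unfolding P_def
    by (intro decidable_conj decidable_eq decidable_ball decidable_disj decidable_le cf cf'
        computable_nth computable_tl computable_const) auto
  have H_comp: "computable (Suc n) H"
    unfolding H_def
    by (intro computable_if decidable_bex dP computable_Least decidable_disj decidable_le
        computable_nth computable_tl computable_Suc computable_const) auto
  have "\<not> i < j" if "P i ys" "P j ys" for i j ys
    using that by (auto simp: P_def dest!: spec[of _ i])
  then have unique: "i = j" if "P i ys" "P j ys" for i j ys
    using that by (meson linorder_neqE_nat)
  have "H ys = Suc z \<longleftrightarrow> z \<le> ys ! 0 \<and> P z ys" for ys z
  proof -
    have "(LEAST i. P i ys \<or> ys ! 0 \<le> i) = i" if "i \<le> ys ! 0" "P i ys" for i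
      using that by (intro Least_equality) (auto dest: unique)
    then show ?thesis
      by (auto simp: H_def)
  qed
  then have H_eq: "H (s # xs) = Suc z \<longleftrightarrow> z \<le> s \<and> P z (s # xs)" for s xs z
    by simp
  have P_mono: "P z (t # xs)" if len: "length xs = n" and le: "s \<le> t" and "P z (s # xs)" for s t xs z
  proof -
    have "Hf (t # m # xs) = Hf (s # m # xs)" if "Hf (s # m # xs) \<noteq> 0" for m
      using stagesD(2)[OF f _ le, of "m # xs" "Hf (s # m # xs) - 1"] that len by simp
    then show ?thesis
      using \<open>P z (s # xs)\<close> unfolding P_def
      by (metis list.sel(3) not_numeral_le_zero nth_Cons_0 zero_neq_one)
  qed
  have "H (t # xs) = Suc z"
    if "length xs = n" "s \<le> t" "H (s # xs) = Suc z" for s t xs z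
    using that(2,3) P_mono[OF that(1,2)] unfolding H_eq by simp
  moreover have "eval (Mn f) xs z \<longleftrightarrow> (\<exists>s. H (s # xs) = Suc z)" if len: "length xs = n" for xs z
  proof
    assume "eval (Mn f) xs z"
    then have e0: "eval f (z # xs) 0" and eS: "\<And>m. m < z \<Longrightarrow> \<exists>y. eval f (m # xs) (Suc y)"
      by (auto elim: eval_MnE)
    obtain u where u: "Hf (u # z # xs) = 1"
      using e0 stagesD(3)[OF f, of "z # xs" 0] len by auto
    have "\<exists>s. 2 \<le> Hf (s # m # xs)" if m: "m < z" for m
    proof -
      obtain y where "eval f (m # xs) (Suc y)"
        using eS[OF m] by blast
      then obtain s where "Hf (s # m # xs) = Suc (Suc y)"
        using stagesD(3)[OF f, of "m # xs" "Suc y"] len by auto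
      then show ?thesis by (intro exI[of _ s]) simp
    qed
    then obtain s where s: "\<And>m. m < z \<Longrightarrow> 2 \<le> Hf (s m # m # xs)"
      by metis
    \<comment> \<open>Besides the stages of all computations involved, \<open>t\<close> has to
      dominate \<open>z\<close>, because the search at stage \<open>t\<close> reaches only up to
      \<open>t\<close>.\<close>
    define t where "t = Max (insert z (insert u (s ` {..<z})))"
    have mono: "Hf (t # m # xs) = Hf (v # m # xs)" if "v \<le> t" "Hf (v # m # xs) \<noteq> 0" for v m
      using stagesD(2)[OF f _ that(1), of "m # xs" "Hf (v # m # xs) - 1"] that len by simp
    have t: "z \<le> t" "u \<le> t" "\<And>m. m < z \<Longrightarrow> s m \<le> t"
      unfolding t_def by (auto intro!: Max_ge simp del: Max_insert)
    have "2 \<le> Hf (t # m # xs)" if "m < z" for m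
      using s[OF that] mono[OF t(3)[OF that]] by simp
    then have "P z (t # xs)"
      using mono[OF t(2)] u unfolding P_def by (auto simp: order_le_less)
    then show "\<exists>s. H (s # xs) = Suc z"
      unfolding H_eq using t(1) by blast
  next
    assume "\<exists>s. H (s # xs) = Suc z"
    then obtain s where s: "P z (s # xs)"
      unfolding H_eq by blast
    show "eval (Mn f) xs z"
    proof (rule eval_Mn)
      show "eval f (z # xs) 0"
        using s stagesD(3)[OF f, of "z # xs"] len by (auto simp: P_def)
      show "\<forall>m<z. \<exists>y. eval f (m # xs) (Suc y)"
      proof (intro allI impI)
        fix m assume "m < z"
        then have "Hf (s # m # xs) = Suc (Suc (Hf (s # m # xs) - 2))"
          using s by (auto simp: P_def dest!: spec[of _ m])
        then show "\<exists>y. eval f (m # xs) (Suc y)"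
          using stagesD(3)[OF f, of "m # xs"] len by auto
      qed
    qed
  qed
  ultimately have "stages n (eval (Mn f)) H"
    unfolding stages_def using H_comp by blast
  then show ?thesis by blast
qed

lemma stages_never: "(\<And>xs z. length xs = n \<Longrightarrow> \<not> R xs z) \<Longrightarrow> stages n R (\<lambda>_. 0)"
  by (simp add: stages_def computable_const)

text \<open>For a fixed program a step-bounded simulation is built by structural induction, which
  avoids coding programs as numbers. The arity is kept arbitrary because subprograms are called with
  other numbers of arguments.\<close>

theorem stages_eval: "\<exists>H. stages n (eval p) H"
proof (induction p arbitrary: n)
  case Z
  have "stages n (eval Z) (\<lambda>_. 1)"
    unfolding stages_def by (auto simp: computable_const intro: eval_Z elim: eval_ZE)
  then show ?case by blast
next
  case S
  show ?case
  proof (cases n)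
    case 0
    have "stages n (eval S) (\<lambda>_. 0)"
      by (rule stages_never) (auto simp: 0 elim: eval_SE)
    then show ?thesis by blast
  next
    case (Suc m)
    have "stages n (eval S) (\<lambda>ys. Suc (Suc (ys ! 1)))"
      unfolding stages_def
      by (auto simp: Suc length_Suc_conv intro!: computable_intros intro: eval_S elim: eval_SE)
    then show ?thesis by blast
  qed
next
  case (Id i)
  show ?case
  proof (cases "i < n")
    case True
    have "stages n (eval (Id i)) (\<lambda>ys. Suc (ys ! Suc i))"
      unfolding stages_def
      using True by (auto intro!: computable_intros intro: eval_Id elim: eval_IdE)
    then show ?thesis by blast
  next
    case False
    have "stages n (eval (Id i)) (\<lambda>_. 0)"
      by (rule stages_never) (use False in \<open>auto elim: eval_IdE\<close>)
    then show ?thesis by blast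
  qed
next
  case (Cn f gs)
  obtain Hf where "stages (length gs) (eval f) Hf"
    using Cn(1) by blast
  moreover have "\<forall>g. \<exists>H. g \<in> set gs \<longrightarrow> stages n (eval g) H"
    using Cn(2) by blast
  from choice[OF this] obtain Hg where "\<And>g. g \<in> set gs \<Longrightarrow> stages n (eval g) (Hg g)"
    by blast
  ultimately show ?case
    by (rule stages_eval_Cn)
next
  case (Pr f g)
  show ?case
  proof (cases n)
    case 0
    have "stages n (eval (Pr f g)) (\<lambda>_. 0)"
      by (rule stages_never) (auto simp: 0 elim: eval_PrE)
    then show ?thesis by blast
  next
    case (Suc m)
    obtain Hf where f: "stages m (eval f) Hf"
      using Pr(1) by blast
    obtain Hg where g: "stages (Suc (Suc m)) (eval g) Hg"
      using Pr(2) by blast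
    show ?thesis
      using stages_eval_Pr[OF f g] Suc by simp
  qed
next
  case (Mn f)
  obtain Hf where f: "stages (Suc n) (eval f) Hf"
    using Mn by blast
  show ?case
    by (rule stages_eval_Mn[OF f])
qed

section \<open>Determinism and enumerability\<close>

lemma eval_deterministic:
  assumes "eval p xs y" "eval p xs z"
  shows "y = z"
proof -
  obtain H where H: "stages (length xs) (eval p) H"
    using stages_eval by blast
  obtain s t where s: "H (s # xs) = Suc y" and t: "H (t # xs) = Suc z"
    using assms stagesD(3)[OF H refl] by blast
  show ?thesis
    using stagesD(2)[OF H refl max.cobounded1[of s t] s]
      stagesD(2)[OF H refl max.cobounded2[of t s] t] by simp
qed

text \<open>Unbounded search halts exactly on the projection of a decidable predicate; this is the
  source of computable enumerability.\<close>

lemma search_halts_iff: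
  assumes "decidable (Suc n) P"
  obtains p where "\<And>xs. length xs = n \<Longrightarrow> (\<exists>y. eval p xs y) \<longleftrightarrow> (\<exists>w. P (w # xs))"
proof -
  obtain p where p': "\<And>ys. length ys = Suc n \<Longrightarrow> eval p ys (if \<not> P ys then 1 else 0)"
    using decidable_not[OF assms] unfolding decidable_def computable_def by blast
  have p: "eval p (i # xs) (if P (i # xs) then 0 else Suc 0)" if "length xs = n" for i xs
    using p'[of "i # xs"] that by (cases "P (i # xs)") auto
  have "(\<exists>y. eval (Mn p) xs y) \<longleftrightarrow> (\<exists>w. P (w # xs))" if len: "length xs = n" for xs
  proof
    assume "\<exists>y. eval (Mn p) xs y"
    then obtain y where "eval p (y # xs) 0"
      by (auto elim: eval_MnE)
    from eval_deterministic[OF this p[OF len]] have "P (y # xs)"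
      by (auto split: if_splits)
    then show "\<exists>w. P (w # xs)" ..
  next
    assume ex: "\<exists>w. P (w # xs)"
    have "eval (Mn p) xs (LEAST w. P (w # xs))"
    proof (rule eval_Mn)
      show "eval p ((LEAST w. P (w # xs)) # xs) 0"
        using p[OF len, of "LEAST w. P (w # xs)"] LeastI_ex[OF ex] by simp
      show "\<forall>m<LEAST w. P (w # xs). \<exists>y. eval p (m # xs) (Suc y)"
        using p[OF len] not_less_Least by (metis (mono_tags, lifting))
    qed
    then show "\<exists>y. eval (Mn p) xs y" ..
  qed
  then show thesis
    using that by blast
qed

section \<open>Strings and their codes\<close>

lemma str_to_nat_Nil: "str_to_nat [] = 0"
  by (simp add: str_to_nat_def)

text \<open>The fold computes the number with binary expansion \<open>1x\<close>, which has
  \<open>length x + 1\<close> digits.\<close>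

lemma foldl_binary_bounds:
  "2 ^ length x \<le> foldl (\<lambda>n b. 2 * n + (if b then 1 else 0 :: nat)) 1 x \<and>
   foldl (\<lambda>n b. 2 * n + (if b then 1 else 0 :: nat)) 1 x < 2 ^ (length x + 1)"
  by (induction x rule: rev_induct) auto

lemma str_to_nat_bounds: "2 ^ length x \<le> str_to_nat x + 1" "str_to_nat x + 1 < 2 ^ (length x + 1)"
  using foldl_binary_bounds[of x] one_le_power[of "2::nat" "length x"]
  unfolding str_to_nat_def by linarith+

text \<open>This is bijective base 2, with digits 1 and 2. Every positive number is uniquely
  \<open>2 * m + 1\<close> or \<open>2 * m + 2\<close>, whence injectivity and surjectivity by
  peeling off the last bit.\<close>

lemma str_to_nat_snoc: "str_to_nat (x @ [b]) = 2 * str_to_nat x + (if b then 2 else 1)"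
  using foldl_binary_bounds[of x] one_le_power[of "2::nat" "length x"]
  by (auto simp: str_to_nat_def)

lemma inj_str_to_nat: "inj str_to_nat"
proof
  fix x y
  show "str_to_nat x = str_to_nat y \<Longrightarrow> x = y"
  proof (induction x arbitrary: y rule: rev_induct)
    case Nil
    then show ?case
      by (cases y rule: rev_cases) (auto simp: str_to_nat_Nil str_to_nat_snoc split: if_splits)
  next
    case (snoc b x)
    then obtain c z where y: "y = z @ [c]"
      by (cases y rule: rev_cases) (auto simp: str_to_nat_Nil str_to_nat_snoc split: if_splits)
    have "str_to_nat x = str_to_nat z \<and> b = c"
      using snoc.prems unfolding y str_to_nat_snoc by (auto split: if_splits; presburger)
    then show ?case
      using snoc.IH y by blast
  qed
qed

lemma surj_str_to_nat: "\<exists>x. str_to_nat x = n"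
proof (induction n rule: less_induct)
  case (less n)
  show ?case
  proof (cases "n = 0")
    case True
    then show ?thesis using str_to_nat_Nil by blast
  next
    case False
    then obtain x where x: "str_to_nat x = (n - 1) div 2"
      using less[of "(n - 1) div 2"] le_less_trans[OF div_le_dividend, of "n - 1" n 2] by auto
    have "str_to_nat (x @ [even n]) = n"
      using False x unfolding str_to_nat_snoc by (auto; presburger)
    then show ?thesis by blast
  qed
qed

section \<open>Optimality in terms of program codes\<close>

lemma KC_le_iff: "KC T x \<le> enat n \<longleftrightarrow> (\<exists>y. runs T y x \<and> length y \<le> n)"
proof
  assume "KC T x \<le> enat n"
  then have "KC T x < enat (Suc n)"
    by (rule le_less_trans) simp
  then show "\<exists>y. runs T y x \<and> length y \<le> n"
    unfolding KC_def INF_less_iff by auto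
next
  assume "\<exists>y. runs T y x \<and> length y \<le> n"
  then obtain y where y: "runs T y x" "length y \<le> n"
    by blast
  have "KC T x \<le> enat (length y)"
    unfolding KC_def by (rule INF_lower) (simp add: y)
  then show "KC T x \<le> enat n"
    using y(2) by (meson enat_ord_simps(1) order_trans)
qed

text \<open>An additive constant in lengths becomes a factor on \<open>q + 1\<close>, since
  \<open>q + 1\<close> lies between \<open>2 ^ length y\<close> and
  \<open>2 ^ (length y + 1)\<close>. From here on programs are treated as numbers.\<close>

lemma optimal_codes:
  assumes "optimal U"
  shows "\<exists>c. \<forall>q x. eval T [q] x \<longrightarrow> (\<exists>r. eval U [r] x \<and> r + 1 \<le> (q + 1) * 2 ^ c)"
proof -
  obtain c where c: "\<And>x. KC U x \<le> KC T x + enat c"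
    using assms unfolding optimal_def by blast
  have "\<exists>r. eval U [r] x \<and> r + 1 \<le> (q + 1) * 2 ^ (c + 1)" if ev: "eval T [q] x" for q x
  proof -
    obtain y z where y: "str_to_nat y = q" and z: "str_to_nat z = x"
      using surj_str_to_nat by metis
    have "KC T z \<le> enat (length y)"
      unfolding KC_le_iff runs_def using ev y z by blast
    then have "KC U z \<le> enat (length y + c)"
      using c[of z] by (metis add_right_mono order_trans plus_enat_simps(1))
    then obtain u where u: "runs U u z" "length u \<le> length y + c"
      unfolding KC_le_iff by blast
    have "str_to_nat u + 1 \<le> 2 ^ (length u + 1)"
      using str_to_nat_bounds(2)[of u] by simp
    also have "\<dots> \<le> 2 ^ (length y + c + 1)"
      using u(2) by (intro power_increasing) auto
    also have "\<dots> = 2 ^ length y * 2 ^ (c + 1)"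
      by (simp add: power_add)
    also have "\<dots> \<le> (q + 1) * 2 ^ (c + 1)"
      using str_to_nat_bounds(1)[of y] y by (intro mult_right_mono) auto
    finally show ?thesis
      using u(1) z unfolding runs_def by blast
  qed
  then show ?thesis by blast
qed

section \<open>Complexity with bounded running time\<close>

text \<open>The maximum of finitely many stages serves. This will show that the searches for a
  sufficiently late stage terminate.\<close>

lemma common_stage:
  fixes Q :: "nat \<Rightarrow> 'a \<Rightarrow> bool"
  assumes "finite I" and "\<And>x. x \<in> I \<Longrightarrow> \<exists>r. Q r x"
    and mono: "\<And>r t x. r \<le> t \<Longrightarrow> Q r x \<Longrightarrow> Q t x"
  shows "\<exists>r. \<forall>x\<in>I. Q r x"
  using assms(1,2)
proof (induction I)
  case empty
  show ?case by simp
next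
  case (insert x I)
  obtain r where r: "\<forall>x\<in>I. Q r x"
    using insert by blast
  obtain t where t: "Q t x"
    using insert by blast
  have "\<forall>y\<in>insert x I. Q (max r t) y"
    using r t mono[of r "max r t"] mono[of t "max r t"] by simp
  then show ?case ..
qed

text \<open>\<open>h s q\<close> is the staged outcome of \<open>U\<close> on the code
  \<open>q\<close>; the assumptions are optimality and the curried form of \<open>stages\<close> for
  arity 1.\<close>

locale staged_optimal =
  fixes U :: recf and h :: "nat \<Rightarrow> nat \<Rightarrow> nat"
  assumes optimal: "optimal U"
    and h_computable: "computable 2 (\<lambda>xs. h (xs ! 0) (xs ! 1))"
    and h_mono: "\<And>s t q x. s \<le> t \<Longrightarrow> h s q = Suc x \<Longrightarrow> h t q = Suc x"
    and eval_U_iff: "\<And>q x. eval U [q] x \<longleftrightarrow> (\<exists>s. h s q = Suc x)"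
begin

lemmas computable_h = computable_compose2[OF h_computable]

lemma h_imp_eval: "h s q = Suc x \<Longrightarrow> eval U [q] x"
  using eval_U_iff by blast

text \<open>\<open>Cn p [U]\<close> is a machine that runs \<open>U\<close> and then applies
  \<open>F\<close>, so optimality bounds the code of the image by that of the preimage.\<close>

lemma short_code_image:
  assumes "computable 1 (\<lambda>xs. F (xs ! 0))"
  shows "\<exists>c. \<forall>q s. eval U [q] s \<longrightarrow> (\<exists>r. eval U [r] (F s) \<and> r + 1 \<le> (q + 1) * 2 ^ c)"
proof -
  obtain p where p: "\<And>xs. length xs = 1 \<Longrightarrow> eval p xs (F (xs ! 0))"
    using assms unfolding computable_def by blast
  have "eval (Cn p [U]) [q] (F s)" if "eval U [q] s" for q s
    using p[of "[s]"] that by (intro eval_Cn[of "[s]"]) auto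
  then show ?thesis
    using optimal_codes[OF optimal, of "Cn p [U]"] by blast
qed

text \<open>Here the machine takes \<open>x\<close> itself as its program, so the bound is in the
  size of \<open>x\<close> and not in its complexity.\<close>

lemma short_code:
  assumes "computable 1 (\<lambda>xs. F (xs ! 0))"
  shows "\<exists>c. \<forall>x. \<exists>r. eval U [r] (F x) \<and> r + 1 \<le> (x + 1) * 2 ^ c"
proof -
  obtain p where p: "\<And>xs. length xs = 1 \<Longrightarrow> eval p xs (F (xs ! 0))"
    using assms unfolding computable_def by blast
  have "eval p [x] (F x)" for x
    using p[of "[x]"] by simp
  then show ?thesis
    using optimal_codes[OF optimal, of p] by blast
qed

text \<open>A code \<open>q\<close> stands for a program of length about \<open>log2 (q + 1)\<close>: the running time \<open>s\<close> has
  complexity at most \<open>k / 2\<close>, and \<open>x\<close> has complexity at most \<open>k\<close> at stage \<open>s\<close>.\<close>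

definition attained :: "nat \<Rightarrow> nat \<Rightarrow> bool" where
  "attained x k \<longleftrightarrow> (\<exists>s q p. eval U [q] s \<and> (q + 1)\<^sup>2 \<le> 2 ^ k \<and> p \<le> s \<and> p + 1 \<le> 2 ^ k \<and> h s p = Suc x)"

text \<open>Both size bounds only relax when \<open>k\<close> grows; hence the least level of
  \<open>x\<close> will determine all its levels.\<close>

lemma attained_mono:
  assumes "attained x k" "k \<le> l"
  shows "attained x l"
proof -
  have "(2::nat) ^ k \<le> 2 ^ l"
    using assms(2) by (rule power_increasing) simp
  then show ?thesis
    using assms(1) unfolding attained_def by (meson order_trans)
qed

section \<open>Counting and enumeration\<close>

lemma attained_short_code:
  assumes "attained x k"
  shows "\<exists>p<2 ^ k. eval U [p] x"
  using assms h_imp_eval unfolding attained_def by (metis Suc_eq_plus1 Suc_le_lessD)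

text \<open>A single witness \<open>w\<close> bounds \<open>q\<close> and is also the stage at which
  \<open>U\<close> outputs the running time \<open>s\<close> on \<open>q\<close>. Once
  \<open>w\<close> is given, all remaining quantifiers are bounded.\<close>

lemma attained_enumerable: "\<exists>p. \<forall>x k. attained x k \<longleftrightarrow> (\<exists>y. eval p [x, k] y)"
proof -
  define P where "P = (\<lambda>ys::nat list. \<exists>q\<le>ys ! 0. h (ys ! 0) q \<noteq> 0 \<and>
    (q + 1) * (q + 1) \<le> 2 ^ (ys ! 2) \<and>
    (\<exists>p\<le>h (ys ! 0) q - 1. p + 1 \<le> 2 ^ (ys ! 2) \<and> h (h (ys ! 0) q - 1) p = Suc (ys ! 1)))"
  have "decidable (Suc 2) P"
    unfolding P_def
    by (intro decidable_bex decidable_conj decidable_not decidable_eq decidable_le computable_h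
        computable_power computable_mult computable_add computable_diff computable_Suc
        computable_tl computable_nth computable_const) auto
  then obtain p where p: "\<And>xs. length xs = 2 \<Longrightarrow> (\<exists>y. eval p xs y) \<longleftrightarrow> (\<exists>w. P (w # xs))"
    by (rule search_halts_iff) blast
  have "attained x k \<longleftrightarrow> (\<exists>w. P [w, x, k])" for x k
  proof
    assume "attained x k"
    then obtain s q p where *: "eval U [q] s" "(q + 1)\<^sup>2 \<le> 2 ^ k" "p \<le> s" "p + 1 \<le> 2 ^ k"
      "h s p = Suc x"
      unfolding attained_def by blast
    obtain t where "h t q = Suc s"
      using *(1) eval_U_iff by blast
    then have "h (max t q) q = Suc s"
      by (rule h_mono[rotated]) simp
    moreover have "\<exists>p\<le>s. p + 1 \<le> 2 ^ k \<and> h s p = Suc x"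
      using *(3,4,5) by blast
    ultimately have "P [max t q, x, k]"
      using *(2) unfolding P_def by (intro exI[of _ q]) (simp add: power2_eq_square)
    then show "\<exists>w. P [w, x, k]" ..
  next
    assume "\<exists>w. P [w, x, k]"
    then obtain w q p where *: "h w q \<noteq> 0" "(q + 1) * (q + 1) \<le> 2 ^ k" "p \<le> h w q - 1"
      "p + 1 \<le> 2 ^ k" "h (h w q - 1) p = Suc x"
      unfolding P_def by auto
    have "eval U [q] (h w q - 1)"
      by (rule h_imp_eval[of w]) (use *(1) in simp)
    then show "attained x k"
      unfolding attained_def power2_eq_square using * by blast
  qed
  moreover have "(\<exists>y. eval p [x, k] y) \<longleftrightarrow> (\<exists>w. P [w, x, k])" for x k
    using p[of "[x, k]"] by simp
  ultimately show ?thesis by blast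
qed

text \<open>A string of length \<open>l / 2\<close> suffices to bound \<open>l\<close>, hence to wait until all strings of length
  at most \<open>l\<close> have received a program of length \<open>l + O(1)\<close>.\<close>

lemma attained_length: "\<exists>c. \<forall>x l. x + 1 < 2 ^ (l + 1) \<longrightarrow> attained x (l + c)"
proof -
  obtain c where c: "\<And>x. \<exists>p. eval U [p] x \<and> p + 1 \<le> (x + 1) * 2 ^ c"
    using short_code[of "\<lambda>x. x"] computable_nth[of 0 1] by auto
  let ?Q = "\<lambda>r x. \<exists>p\<le>r. p + 1 \<le> (x + 1) * 2 ^ c \<and> h r p = Suc x"
  \<comment> \<open>The bound is quadratic in \<open>y + 1\<close> so that \<open>y\<close> needs
    only half as many bits as \<open>x\<close>; the factor 4 absorbs the rounding in
    \<open>l div 2\<close> and the passage from \<open>l\<close> to \<open>l + 1\<close>.\<close>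
  define T where "T = (\<lambda>y::nat. LEAST r. \<forall>x\<le>4 * ((y + 1) * (y + 1)). ?Q r x)"
  have ex: "\<exists>r. \<forall>x\<in>{..N}. ?Q r x" for N
  proof (rule common_stage)
    fix x
    obtain p s where p: "p + 1 \<le> (x + 1) * 2 ^ c" "h s p = Suc x"
      using c eval_U_iff by blast
    have "h (max p s) p = Suc x"
      by (rule h_mono[OF _ p(2)]) simp
    then have "?Q (max p s) x"
      using p(1) by (intro exI[of _ p]) simp
    then show "\<exists>r. ?Q r x" ..
  next
    fix r t x assume "r \<le> t" "?Q r x"
    then show "?Q t x"
      using h_mono by (meson order_trans)
  qed simp
  have "computable 1 (\<lambda>xs. T (xs ! 0))"
    unfolding T_def
  proof (rule computable_Least)
    show "decidable (Suc 1) (\<lambda>ys. \<forall>x\<le>4 * ((tl ys ! 0 + 1) * (tl ys ! 0 + 1)). ?Q (ys ! 0) x)"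
      by (intro decidable_ball decidable_bex decidable_conj decidable_eq decidable_le computable_h
          computable_mult computable_add computable_Suc computable_tl computable_nth
          computable_const) auto
  qed (use ex in \<open>simp add: Ball_def\<close>)
  from short_code[OF this] obtain d where d: "\<And>y. \<exists>q. eval U [q] (T y) \<and> q + 1 \<le> (y + 1) * 2 ^ d"
    by blast
  \<comment> \<open>Squaring doubles the exponent \<open>d\<close> in the code of the running time;
    \<open>c + 1\<close> pays for the program of \<open>x\<close>, as
    \<open>x + 1 < 2 ^ (l + 1)\<close>.\<close>
  have "attained x (l + (2 * d + c + 1))" if x: "x + 1 < 2 ^ (l + 1)" for x l
  proof -
    define y where "y = 2 ^ (l div 2) - (1::nat)"
    have y: "y + 1 = 2 ^ (l div 2)"
      by (simp add: y_def)
    obtain q where q: "eval U [q] (T y)" "q + 1 \<le> (y + 1) * 2 ^ d"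
      using d by blast
    have "(q + 1)\<^sup>2 \<le> ((y + 1) * 2 ^ d)\<^sup>2"
      using q(2) by (rule power_mono) simp
    also have "\<dots> = 2 ^ (2 * (l div 2) + 2 * d)"
      unfolding y by (simp add: power_add power_mult_distrib mult.commute flip: power_mult)
    also have "\<dots> \<le> 2 ^ (l + (2 * d + c + 1))"
      by (rule power_increasing) auto
    finally have q2: "(q + 1)\<^sup>2 \<le> 2 ^ (l + (2 * d + c + 1))" .
    have "2 ^ (l + 1) \<le> (2::nat) ^ (2 + (l div 2 + l div 2))"
      by (rule power_increasing) auto
    also have "\<dots> = 4 * ((y + 1) * (y + 1))"
      unfolding y by (simp add: power_add)
    finally have "x \<le> 4 * ((y + 1) * (y + 1))"
      using x by linarith
    moreover have "\<forall>x\<le>4 * ((y + 1) * (y + 1)). ?Q (T y) x"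
      unfolding T_def by (rule LeastI_ex) (use ex in \<open>simp add: Ball_def\<close>)
    ultimately obtain p where p: "p \<le> T y" "p + 1 \<le> (x + 1) * 2 ^ c" "h (T y) p = Suc x"
      by blast
    note p(2)
    also have "(x + 1) * 2 ^ c \<le> 2 ^ (l + 1) * 2 ^ c"
      using x by (intro mult_right_mono) auto
    also have "\<dots> = 2 ^ (l + 1 + c)"
      by (simp add: power_add)
    also have "\<dots> \<le> 2 ^ (l + (2 * d + c + 1))"
      by (rule power_increasing) auto
    finally show ?thesis
      unfolding attained_def using q(1) q2 p by blast
  qed
  then show ?thesis by blast
qed

text \<open>From \<open>s\<close> one computes a stage at which the images of all numbers found at stage \<open>s\<close> have
  received their programs.\<close>

lemma attained_image:
  assumes F: "computable 1 (\<lambda>xs. F (xs ! 0))"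
  shows "\<exists>c. \<forall>x k. attained x k \<longrightarrow> attained (F x) (k + c)"
proof -
  obtain c where c: "\<And>p x. eval U [p] x \<Longrightarrow> \<exists>r. eval U [r] (F x) \<and> r + 1 \<le> (p + 1) * 2 ^ c"
    using short_code_image[OF F] by blast
  \<comment> \<open>The disjunct \<open>h s p = 0\<close> dismisses codes without output at stage
    \<open>s\<close>; for the others \<open>h s p - 1\<close> is the output.\<close>
  let ?Q = "\<lambda>s r p. h s p = 0 \<or> (\<exists>p'\<le>r. p' + 1 \<le> (p + 1) * 2 ^ c \<and> h r p' = Suc (F (h s p - 1)))"
  define g where "g = (\<lambda>s. LEAST r. \<forall>p\<le>s. ?Q s r p)"
  have ex: "\<exists>r. \<forall>p\<in>{..s}. ?Q s r p" for s
  proof (rule common_stage)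
    fix p
    show "\<exists>r. ?Q s r p"
    proof (cases "h s p")
      case (Suc x)
      obtain p' t where p': "p' + 1 \<le> (p + 1) * 2 ^ c" "h t p' = Suc (F x)"
        using c[OF h_imp_eval[OF Suc]] eval_U_iff by blast
      have "h (max p' t) p' = Suc (F x)"
        by (rule h_mono[OF _ p'(2)]) simp
      then have "?Q s (max p' t) p"
        using p'(1) Suc by (intro disjI2 exI[of _ p']) simp
      then show ?thesis ..
    qed simp
  next
    fix r t p assume "r \<le> t" "?Q s r p"
    then show "?Q s t p"
      using h_mono by (meson order_trans)
  qed simp
  \<comment> \<open>Totality of \<open>F\<close> enters here: only finitely many outputs are found
    at stage \<open>s\<close>, and each image receives its program eventually, so the search
    defining \<open>g\<close> ends for every \<open>s\<close>.\<close>
  have "computable 1 (\<lambda>xs. g (xs ! 0))"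
    unfolding g_def
  proof (rule computable_Least)
    show "decidable (Suc 1) (\<lambda>ys. \<forall>p\<le>tl ys ! 0. ?Q (tl ys ! 0) (ys ! 0) p)"
      by (intro decidable_ball decidable_bex decidable_conj decidable_disj decidable_eq decidable_le
          computable_h computable_compose1[OF F] computable_mult computable_add computable_diff
          computable_Suc computable_tl computable_nth computable_const) auto
  qed (use ex in \<open>simp add: Ball_def\<close>)
  from short_code_image[OF this] obtain d where
    d: "\<And>q s. eval U [q] s \<Longrightarrow> \<exists>r. eval U [r] (g s) \<and> r + 1 \<le> (q + 1) * 2 ^ d"
    by blast
  have "attained (F x) (k + (2 * d + c))" if x: "attained x k" for x k
  proof -
    obtain s q p where *: "eval U [q] s" "(q + 1)\<^sup>2 \<le> 2 ^ k" "p \<le> s" "p + 1 \<le> 2 ^ k"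
      "h s p = Suc x"
      using x unfolding attained_def by blast
    obtain r where r: "eval U [r] (g s)" "r + 1 \<le> (q + 1) * 2 ^ d"
      using d[OF *(1)] by blast
    have "(r + 1)\<^sup>2 \<le> ((q + 1) * 2 ^ d)\<^sup>2"
      using r(2) by (rule power_mono) simp
    also have "\<dots> = (q + 1)\<^sup>2 * 2 ^ (2 * d)"
      by (simp only: power_mult_distrib mult.commute[of 2 d] power_mult)
    also have "\<dots> \<le> 2 ^ k * 2 ^ (2 * d)"
      using *(2) by (rule mult_right_mono) simp
    also have "\<dots> = 2 ^ (k + 2 * d)"
      by (simp add: power_add)
    also have "\<dots> \<le> 2 ^ (k + (2 * d + c))"
      by (rule power_increasing) auto
    finally have r2: "(r + 1)\<^sup>2 \<le> 2 ^ (k + (2 * d + c))" .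
    have "\<forall>p\<le>s. ?Q s (g s) p"
      unfolding g_def by (rule LeastI_ex) (use ex in \<open>simp add: Ball_def\<close>)
    then obtain p' where p': "p' \<le> g s" "p' + 1 \<le> (p + 1) * 2 ^ c" "h (g s) p' = Suc (F x)"
      using *(3,5) by fastforce
    note p'(2)
    also have "(p + 1) * 2 ^ c \<le> 2 ^ k * 2 ^ c"
      using *(4) by (rule mult_right_mono) simp
    also have "\<dots> = 2 ^ (k + c)"
      by (simp add: power_add)
    also have "\<dots> \<le> 2 ^ (k + (2 * d + c))"
      by (rule power_increasing) auto
    finally show ?thesis
      unfolding attained_def using r(1) r2 p' by blast
  qed
  then show ?thesis by blast
qed

text \<open>With \<open>s\<close> the largest number of complexity at most \<open>n\<close>, a number not found by stage \<open>s\<close> is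
  computable from \<open>s\<close>, hence of complexity \<open>n + O(1)\<close>, but not attained at level \<open>2 * n\<close>.\<close>

lemma exists_not_attained: "\<exists>x q k. eval U [q] x \<and> (q + 1) * 2 ^ b \<le> 2 ^ k \<and> \<not> attained x k"
proof -
  define g where "g = (\<lambda>s. LEAST x. \<forall>p\<le>s. h s p \<noteq> Suc x)"
  have ex: "\<exists>x. \<forall>p\<le>s. h s p \<noteq> Suc x" for s
  proof -
    obtain x where "x \<notin> (\<lambda>p. h s p - 1) ` {..s}"
      using ex_new_if_finite[of "(\<lambda>p. h s p - 1) ` {..s}"] by auto
    then show ?thesis
      by (intro exI[of _ x]) force
  qed
  have "computable 1 (\<lambda>xs. g (xs ! 0))"
    unfolding g_def
  proof (rule computable_Least)
    show "decidable (Suc 1) (\<lambda>ys. \<forall>p\<le>tl ys ! 0. h (tl ys ! 0) p \<noteq> Suc (ys ! 0))"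
      by (intro decidable_ball decidable_not decidable_eq computable_h computable_Suc computable_tl
          computable_nth) auto
  qed (rule ex)
  from short_code_image[OF this] obtain c where
    c: "\<And>q s. eval U [q] s \<Longrightarrow> \<exists>r. eval U [r] (g s) \<and> r + 1 \<le> (q + 1) * 2 ^ c"
    by blast
  obtain q0 where q0: "eval U [q0] 0"
    using short_code[of "\<lambda>x. x"] computable_nth[of 0 1] by auto
  \<comment> \<open>The summands \<open>c + b\<close> give \<open>n + c + b \<le> 2 * n\<close>
    below, and \<open>q0\<close> ensures \<open>q0 < 2 ^ n\<close>, so that \<open>B\<close> is
    nonempty.\<close>
  define n where "n = c + b + q0"
  define B where "B = {s. \<exists>q<2 ^ n. eval U [q] s}"
  have "finite ((\<lambda>q. THE s. eval U [q] s) ` {..<2 ^ n})"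
    by simp
  moreover have "B \<subseteq> (\<lambda>q. THE s. eval U [q] s) ` {..<2 ^ n}"
  proof
    fix s assume "s \<in> B"
    then obtain q where q: "q < 2 ^ n" "eval U [q] s"
      unfolding B_def by blast
    have "(THE s. eval U [q] s) = s"
      using q(2) eval_deterministic by blast
    then show "s \<in> (\<lambda>q. THE s. eval U [q] s) ` {..<2 ^ n}"
      using q(1) by force
  qed
  ultimately have fin: "finite B"
    by (rule finite_subset[rotated])
  have "q0 < 2 ^ n"
    using less_exp[of n] unfolding n_def by linarith
  then have "B \<noteq> {}"
    using q0 unfolding B_def by blast
  then have "Max B \<in> B"
    using fin by (rule Max_in[rotated])
  then obtain q where q: "q < 2 ^ n" "eval U [q] (Max B)"
    unfolding B_def by blast
  obtain r where r: "eval U [r] (g (Max B))" "r + 1 \<le> (q + 1) * 2 ^ c"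
    using c[OF q(2)] by blast
  have "(r + 1) * 2 ^ b \<le> (q + 1) * 2 ^ c * 2 ^ b"
    using r(2) by (rule mult_right_mono) simp
  also have "\<dots> \<le> 2 ^ n * 2 ^ c * 2 ^ b"
    using q(1) by (intro mult_right_mono) auto
  also have "\<dots> = 2 ^ (n + c + b)"
    by (simp add: power_add)
  also have "\<dots> \<le> 2 ^ (2 * n)"
    by (rule power_increasing) (auto simp: n_def)
  finally have "(r + 1) * 2 ^ b \<le> 2 ^ (2 * n)" .
  moreover have "\<not> attained (g (Max B)) (2 * n)"
  proof
    assume "attained (g (Max B)) (2 * n)"
    then obtain s u p where *: "eval U [u] s" "(u + 1)\<^sup>2 \<le> 2 ^ (2 * n)" "p \<le> s"
      "h s p = Suc (g (Max B))"
      unfolding attained_def by blast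
    have "(u + 1)\<^sup>2 \<le> (2 ^ n)\<^sup>2"
      using *(2) by (simp add: mult.commute flip: power_mult)
    then have "u + 1 \<le> 2 ^ n"
      by (rule power2_le_imp_le) simp
    then have "s \<in> B"
      using *(1) unfolding B_def by (auto intro!: exI[of _ u])
    then have "s \<le> Max B"
      using fin by simp
    moreover have "\<forall>p\<le>Max B. h (Max B) p \<noteq> Suc (g (Max B))"
      unfolding g_def by (rule LeastI_ex) (rule ex)
    ultimately show False
      using h_mono[OF _ *(4)] *(3) by (meson order_trans)
  qed
  ultimately show ?thesis
    using r(1) by blast
qed

end

section \<open>The function \<open>A\<close> and its properties\<close>

theorem theorem2:
  assumes "optimal U"
  shows "\<exists>A :: bool list \<Rightarrow> nat.
           upper_semicomputable A
         \<and> (\<exists>c::nat. \<forall>x. A x \<le> length x + c)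
         \<and> (\<exists>d::nat. \<forall>n::nat. finite {x. A x \<le> n} \<and> card {x. A x \<le> n} \<le> d * 2 ^ n)
         \<and> (\<forall>f. total_computable f \<longrightarrow> (\<exists>cf::nat. \<forall>x. A (f x) \<le> A x + cf))
         \<and> (\<forall>b::nat. \<exists>x. enat (A x) + enat b < KC U x \<or> KC U x + enat b < enat (A x))"
proof -
  obtain H where H: "stages 1 (eval U) H"
    using stages_eval by blast
  have "computable 2 (\<lambda>xs. H (map (\<lambda>G. G xs) [\<lambda>xs. xs ! 0, \<lambda>xs. xs ! 1]))"
    by (rule computable_compose)
      (use stagesD(1)[OF H] in \<open>auto intro: computable_nth simp: numeral_2_eq_2\<close>)
  then interpret staged_optimal U "\<lambda>s q. H [s, q]"
    using stagesD(2,3)[OF H, of "[_]"] assms by unfold_locales auto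
  define A where "A = (\<lambda>x. LEAST k. attained (str_to_nat x) k)"
  obtain c where c: "\<And>x l. x + 1 < 2 ^ (l + 1) \<Longrightarrow> attained x (l + c)"
    using attained_length by blast
  have A_le: "A x \<le> k \<longleftrightarrow> attained (str_to_nat x) k" for x k
  proof
    have "attained (str_to_nat x) (A x)"
      unfolding A_def by (rule LeastI, rule c) (rule str_to_nat_bounds(2))
    then show "A x \<le> k \<Longrightarrow> attained (str_to_nat x) k"
      by (rule attained_mono)
  qed (simp add: A_def Least_le)
  have "upper_semicomputable A"
    unfolding upper_semicomputable_def A_le using attained_enumerable by blast
  moreover have "A x \<le> length x + c" for x
    unfolding A_le by (rule c) (rule str_to_nat_bounds(2))
  moreover have "finite {x. A x \<le> n} \<and> card {x. A x \<le> n} \<le> 1 * 2 ^ n" for n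
  proof -
    \<comment> \<open>Each \<open>x\<close> with \<open>A x \<le> n\<close> is assigned a program
      below \<open>2 ^ n\<close>; determinism of \<open>U\<close> makes the assignment injective, so
      \<open>d = 1\<close> works.\<close>
    have "\<forall>x. \<exists>p. A x \<le> n \<longrightarrow> p < 2 ^ n \<and> eval U [p] (str_to_nat x)"
      using attained_short_code unfolding A_le by blast
    from choice[OF this] obtain P where
      P: "\<And>x. A x \<le> n \<Longrightarrow> P x < 2 ^ n" "\<And>x. A x \<le> n \<Longrightarrow> eval U [P x] (str_to_nat x)"
      by blast
    have "inj_on P {x. A x \<le> n}"
    proof (rule inj_onI)
      fix x y assume "x \<in> {x. A x \<le> n}" "y \<in> {x. A x \<le> n}" "P x = P y"
      then have "str_to_nat x = str_to_nat y"
        using P(2)[of x] P(2)[of y] eval_deterministic by simp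
      then show "x = y"
        using inj_str_to_nat by (simp add: inj_eq)
    qed
    moreover have "P ` {x. A x \<le> n} \<subseteq> {..<2 ^ n}"
      using P(1) by auto
    ultimately show ?thesis
      using inj_on_finite[of P _ "{..<2 ^ n}"] card_inj_on_le[of P _ "{..<2 ^ n}"] by auto
  qed
  moreover have "\<exists>cf. \<forall>x. A (f x) \<le> A x + cf" if f: "total_computable f" for f
  proof -
    obtain p where p: "\<And>x. eval p [str_to_nat x] (str_to_nat (f x))"
      using f unfolding total_computable_def runs_def by blast
    define F where "F = (\<lambda>n. str_to_nat (f (inv str_to_nat n)))"
    have "eval p [n] (F n)" for n
      using p[of "inv str_to_nat n"] surj_str_to_nat[of n] unfolding F_def
      by (metis f_inv_into_f rangeI)
    then have "computable 1 (\<lambda>xs. F (xs ! 0))"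
      unfolding computable_def by (intro exI[of _ p]) (auto simp: length_Suc_conv)
    from attained_image[OF this] obtain d where d: "\<And>x k. attained x k \<Longrightarrow> attained (F x) (k + d)"
      by blast
    have "F (str_to_nat x) = str_to_nat (f x)" for x
      by (simp add: F_def inj_str_to_nat)
    then have "A (f x) \<le> A x + d" for x
      using d[of "str_to_nat x" "A x"] A_le[of x "A x"] by (simp add: A_le)
    then show ?thesis by blast
  qed
  \<comment> \<open>Of the two alternatives the second is established: \<open>A\<close> exceeds
    \<open>C\<close> by more than \<open>b\<close>.\<close>
  moreover have "\<exists>x. KC U x + enat b < enat (A x)" for b
  proof -
    obtain n q k where q: "eval U [q] n" "(q + 1) * 2 ^ b \<le> 2 ^ k" "\<not> attained n k"
      using exists_not_attained by blast
    obtain x y where x: "str_to_nat x = n" and y: "str_to_nat y = q"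
      using surj_str_to_nat by metis
    have "KC U x \<le> enat (length y)"
      unfolding KC_le_iff runs_def using q(1) x y by blast
    then have "KC U x + enat b \<le> enat (length y + b)"
      by (metis add_right_mono plus_enat_simps(1))
    \<comment> \<open>The factor \<open>2 ^ b\<close> on the code becomes the summand
      \<open>b\<close> on the length of the program.\<close>
    moreover have "(2::nat) ^ (length y + b) \<le> 2 ^ k"
    proof -
      have "2 ^ length y * 2 ^ b \<le> (q + 1) * 2 ^ b"
        using str_to_nat_bounds(1)[of y] y by (intro mult_right_mono) auto
      then show ?thesis
        using q(2) by (simp add: power_add)
    qed
    then have "length y + b \<le> k"
      by simp
    moreover have "k < A x"
      using q(3) A_le[of x k] x by simp
    ultimately have "KC U x + enat b < enat (A x)"
      by (meson enat_ord_simps(2) le_less_trans)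
    then show ?thesis ..
  qed
  ultimately show ?thesis
    by (intro exI[of _ A] conjI) blast+
qed

end
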